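(* Let $\mathbf{k}=\mathbb{R}$ and $q\in\mathbb{R}\setminus\{-1,1\}$. Then the family $(L^{(q)}_{n,I})_{n\ge0,\,I\subseteq[n-1]}$ is a basis of $\operatorname{QSym}$.
   Context: Let $x_1,x_2,\dots$ be commuting indeterminates and $\operatorname{QSym}\subseteq\mathbb{R}[[x_1,x_2,\dots]]$ the ring of quasisymmetric functions (bounded-degree power series where for every $i_1<\cdots<i_p$ the coefficient of $x_{i_1}^{k_1}\cdots x_{i_p}^{k_p}$ equals that of $x_1^{k_1}\cdots x_p^{k_p}$), viewed as a real vector space. Let $\mathbb{P}^{\pm}=\{\pm1,\pm2,\dots\}$ totally ordered by $-1<1<-2<2<\cdots$. For $\pi=\pi_1\cdots\pi_n\in S_n$, define $L^{(q)}_{n,I}=\sum_f\prod_{i=1}^n q^{[f(i)<0]}x_{|f(i)|}$, summing over maps $f:[n]\to\mathbb{P}^{\pm}$ such that for all $a<b$ in $[n]$, with $i=\pi_a$, $j=\pi_b$: if $i<j$ then $f(i)<f(j)$ or $f(i)=f(j)>0$, and if $i>j$ then $f(i)<f(j)$ or $f(i)=f(j)<0$; here $[f(i)<0]\in\{0,1\}$ indicates negativity and $\pi$ is any permutation with $\operatorname{Des}(\pi)=\{i:\pi(i)>\pi(i+1)\}=I$ (the result depends only on $n$ and $I$). $[n-1]=\emptyset$ for $n\le1$. *)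

theory Defs
  imports Complex_Main "HOL-Library.Poly_Mapping" "HOL-Library.FuncSet"
    "HOL-Combinatorics.Permutations"
begin

text \<open>
  A monomial in the indeterminates \<open>x\<^sub>1, x\<^sub>2, \<dots>\<close> is a finitely supported exponent vector
  \<open>nat \<Rightarrow>\<^sub>0 nat\<close>. There is no \<open>x\<^sub>0\<close>, so power series have no monomial
  with key \<open>0\<close> in their support; with this restriction the type below is
  \<open>\<real>[[x\<^sub>1, x\<^sub>2, \<dots>]]\<close>.
\<close>

typedef series = "{F :: (nat \<Rightarrow>\<^sub>0 nat) \<Rightarrow> real. \<forall>m. 0 \<in> Poly_Mapping.keys m \<longrightarrow> F m = 0}"
  morphisms coeff Abs_series
  by (rule exI[of _ "\<lambda>_. 0"]) simp

setup_lifting type_definition_series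

instantiation series :: real_vector
begin

lift_definition zero_series :: series is "\<lambda>_. 0" by simp
lift_definition plus_series :: "series \<Rightarrow> series \<Rightarrow> series" is "\<lambda>F G m. F m + G m" by simp
lift_definition minus_series :: "series \<Rightarrow> series \<Rightarrow> series" is "\<lambda>F G m. F m - G m" by simp
lift_definition uminus_series :: "series \<Rightarrow> series" is "\<lambda>F m. - F m" by simp
lift_definition scaleR_series :: "real \<Rightarrow> series \<Rightarrow> series" is "\<lambda>c F m. c * F m" by simp

instance
  by standard (transfer; simp add: fun_eq_iff algebra_simps)+

end

definition mon_degree :: "(nat \<Rightarrow>\<^sub>0 nat) \<Rightarrow> nat" where
  "mon_degree m = (\<Sum>i\<in>Poly_Mapping.keys m. Poly_Mapping.lookup m i)"

definition bounded_degree :: "series \<Rightarrow> bool" where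
  "bounded_degree F \<longleftrightarrow> (\<exists>d. \<forall>m. coeff F m \<noteq> 0 \<longrightarrow> mon_degree m \<le> d)"

definition QSym :: "series set" where
  "QSym = {F. bounded_degree F \<and>
     (\<forall>p (i :: nat \<Rightarrow> nat) (k :: nat \<Rightarrow> nat).
        strict_mono_on {1..p} i \<longrightarrow> (\<forall>j\<in>{1..p}. i j \<ge> 1 \<and> k j \<ge> 1) \<longrightarrow>
        coeff F (\<Sum>j\<in>{1..p}. Poly_Mapping.single (i j) (k j)) =
        coeff F (\<Sum>j\<in>{1..p}. Poly_Mapping.single j (k j)))}"

text \<open>The alphabet \<open>\<plusminus>1, \<plusminus>2, \<dots>\<close> is the set of nonzero integers, but it is ordered by
  \<open>-1 < 1 < -2 < 2 < \<dots>\<close> instead of the usual order on \<open>int\<close>.\<close>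

definition signed_alphabet :: "int set" where
  "signed_alphabet = - {0}"

definition pm_less :: "int \<Rightarrow> int \<Rightarrow> bool" (infix "\<prec>" 50) where
  "u \<prec> v \<longleftrightarrow> \<bar>u\<bar> < \<bar>v\<bar> \<or> \<bar>u\<bar> = \<bar>v\<bar> \<and> u < v"

definition Des :: "nat \<Rightarrow> (nat \<Rightarrow> nat) \<Rightarrow> nat set" where
  "Des n \<pi> = {i \<in> {1..n-1}. \<pi> i > \<pi> (i + 1)}"

definition enriched_partitions :: "nat \<Rightarrow> (nat \<Rightarrow> nat) \<Rightarrow> (nat \<Rightarrow> int) set" where
  "enriched_partitions n \<pi> = {f \<in> {1..n} \<rightarrow>\<^sub>E signed_alphabet.
     \<forall>a\<in>{1..n}. \<forall>b\<in>{1..n}. a < b \<longrightarrow>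
       (\<pi> a < \<pi> b \<longrightarrow> f (\<pi> a) \<prec> f (\<pi> b) \<or> f (\<pi> a) = f (\<pi> b) \<and> f (\<pi> a) > 0) \<and>
       (\<pi> a > \<pi> b \<longrightarrow> f (\<pi> a) \<prec> f (\<pi> b) \<or> f (\<pi> a) = f (\<pi> b) \<and> f (\<pi> a) < 0)}"

definition mon_of :: "nat \<Rightarrow> (nat \<Rightarrow> int) \<Rightarrow> (nat \<Rightarrow>\<^sub>0 nat)" where
  "mon_of n f = (\<Sum>i\<in>{1..n}. Poly_Mapping.single (nat \<bar>f i\<bar>) 1)"

lemma lookup_mon_of: "Poly_Mapping.lookup (mon_of n f) v = card {i \<in> {1..n}. nat \<bar>f i\<bar> = v}"
proof -
  have "Poly_Mapping.lookup (mon_of n f) v = (\<Sum>i\<in>{1..n}. if nat \<bar>f i\<bar> = v then 1 else 0)"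
    unfolding mon_of_def lookup_sum by (rule sum.cong) (auto simp: lookup_single when_def)
  also have "\<dots> = card {i \<in> {1..n}. nat \<bar>f i\<bar> = v}"
    by (simp add: sum.If_cases Int_def)
  finally show ?thesis .
qed

lemma zero_notin_keys_mon_of:
  assumes "f \<in> {1..n} \<rightarrow>\<^sub>E signed_alphabet"
  shows "0 \<notin> Poly_Mapping.keys (mon_of n f)"
proof -
  have "{i \<in> {1..n}. nat \<bar>f i\<bar> = 0} = {}"
    using assms by (auto simp: PiE_def Pi_def signed_alphabet_def)
  then show ?thesis
    by (metis card.empty in_keys_iff lookup_mon_of)
qed

lemma sum_fibre_eq_0:
  assumes "0 \<in> Poly_Mapping.keys m"
  shows "(\<Sum>f\<in>{f \<in> enriched_partitions n \<pi>. mon_of n f = m}. w f) = (0::real)"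
proof -
  have "{f \<in> enriched_partitions n \<pi>. mon_of n f = m} = {}"
    using assms zero_notin_keys_mon_of by (auto simp: enriched_partitions_def)
  then show ?thesis by (simp only: sum.empty)
qed

text \<open>The infinite sum over \<open>f\<close> is formed coefficientwise: the coefficient of a monomial collects
  the finitely many \<open>f\<close> (see \<open>finite_fibre\<close>) that contribute this monomial.\<close>

lift_definition L_perm :: "real \<Rightarrow> nat \<Rightarrow> (nat \<Rightarrow> nat) \<Rightarrow> series" is
  "\<lambda>q n \<pi> m. \<Sum>f\<in>{f \<in> enriched_partitions n \<pi>. mon_of n f = m}.
       \<Prod>i\<in>{1..n}. q ^ of_bool (f i < 0)"
  by (rule sum_fibre_eq_0)

text \<open>The choice of \<open>\<pi>\<close> is immaterial, by \<open>ex_perm_Des\<close> and \<open>L_perm_eq_Lq\<close>.\<close>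

definition Lq :: "real \<Rightarrow> nat \<Rightarrow> nat set \<Rightarrow> series" where
  "Lq q n I = L_perm q n (SOME \<pi>. \<pi> permutes {1..n} \<and> Des n \<pi> = I)"

definition Lq_index :: "(nat \<times> nat set) set" where
  "Lq_index = {(n, I). I \<subseteq> {1..n-1}}"

lemma finite_fibre: "finite {f \<in> enriched_partitions n \<pi>. mon_of n f = m}"
proof (rule finite_subset)
  define B where "B = (\<lambda>v. int v) ` Poly_Mapping.keys m \<union> (\<lambda>v. - int v) ` Poly_Mapping.keys m"
  show "finite ({1..n} \<rightarrow>\<^sub>E B)"
    by (rule finite_PiE) (auto simp: B_def)
  show "{f \<in> enriched_partitions n \<pi>. mon_of n f = m} \<subseteq> {1..n} \<rightarrow>\<^sub>E B"
  proof
    fix f assume f: "f \<in> {f \<in> enriched_partitions n \<pi>. mon_of n f = m}"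
    have "f i \<in> B" if i: "i \<in> {1..n}" for i
    proof -
      have "card {j \<in> {1..n}. nat \<bar>f j\<bar> = nat \<bar>f i\<bar>} \<noteq> 0"
        using i by auto
      then have "Poly_Mapping.lookup (mon_of n f) (nat \<bar>f i\<bar>) \<noteq> 0"
        unfolding lookup_mon_of .
      then have "nat \<bar>f i\<bar> \<in> Poly_Mapping.keys m"
        using f by (auto simp: in_keys_iff)
      then show ?thesis
        unfolding B_def by (cases "f i \<ge> 0") (auto intro: rev_image_eqI)
    qed
    then show "f \<in> {1..n} \<rightarrow>\<^sub>E B"
      using f by (auto simp: enriched_partitions_def PiE_def)
  qed
qed

lemma ex_perm_Des:
  assumes "I \<subseteq> {1..n-1}"
  shows "\<exists>\<pi>. \<pi> permutes {1..n} \<and> Des n \<pi> = I"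
  using assms
proof (induction n arbitrary: I)
  case 0
  then show ?case by (intro exI[of _ id]) (auto simp: Des_def)
next
  case (Suc n)
  obtain \<pi> where \<pi>: "\<pi> permutes {1..n}" "Des n \<pi> = I \<inter> {1..n-1}"
    using Suc.IH[of "I \<inter> {1..n-1}"] by blast
  have ran: "\<pi> j \<in> {1..n}" if "j \<in> {1..n}" for j
    using permutes_in_image[OF \<pi>(1)] that by blast
  have D: "\<pi> j > \<pi> (Suc j) \<longleftrightarrow> j \<in> I" if "j \<ge> 1" "j < n" for j
  proof -
    have "j \<in> Des n \<pi> \<longleftrightarrow> j \<in> I \<inter> {1..n-1}" unfolding \<pi>(2) ..
    moreover have "j \<in> {1..n-1}" using that by auto
    ultimately show ?thesis by (simp add: Des_def)
  qed
  show ?case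
  proof (cases "n \<in> I")
    case False
    have "\<pi> permutes {1..Suc n}"
      using \<pi>(1) by (rule permutes_subset) auto
    moreover have "Des (Suc n) \<pi> = I"
    proof -
      have "\<pi> (Suc n) = Suc n" using \<pi>(1) by (rule permutes_not_in) simp
      then have "\<pi> j > \<pi> (Suc j) \<longleftrightarrow> j \<in> I" if "j \<in> {1..n}" for j
        using D[of j] ran[OF that] that False by (cases "j = n") simp_all
      then have "Des (Suc n) \<pi> = {1..n} \<inter> I"
        unfolding Des_def by auto
      then show ?thesis using Suc.prems by auto
    qed
    ultimately show ?thesis by blast
  next
    case True
    then have n1: "n \<ge> 1" using Suc.prems by auto
    define \<rho> where "\<rho> j = (if j \<in> {1..n} then Suc (\<pi> j) else if j = Suc n then 1 else j)" for j
    have pos: "\<pi> j \<noteq> 0" if "j \<in> {1..n}" for j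
      using ran[OF that] by simp
    have "inj_on \<rho> {1..Suc n}"
    proof (rule inj_onI)
      fix a b assume "a \<in> {1..Suc n}" "b \<in> {1..Suc n}" "\<rho> a = \<rho> b"
      then show "a = b"
        using pos[of a] pos[of b] inj_eq[OF permutes_inj[OF \<pi>(1)], of a b]
        by (cases "a = Suc n"; cases "b = Suc n") (auto simp: \<rho>_def le_Suc_eq)
    qed
    moreover have "\<rho> ` {1..Suc n} \<subseteq> {1..Suc n}"
    proof (rule image_subsetI)
      fix a assume "a \<in> {1..Suc n}"
      then show "\<rho> a \<in> {1..Suc n}" using ran[of a] by (simp add: \<rho>_def)
    qed
    ultimately have "bij_betw \<rho> {1..Suc n} {1..Suc n}"
      by (metis bij_betw_def endo_inj_surj finite_atLeastAtMost)
    then have "\<rho> permutes {1..Suc n}"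
      by (rule bij_imp_permutes) (auto simp: \<rho>_def)
    moreover have "Des (Suc n) \<rho> = I"
    proof -
      have "\<rho> j > \<rho> (Suc j) \<longleftrightarrow> j \<in> I" if "j \<in> {1..n}" for j
        using D[of j] ran[OF that] that True by (cases "j = n") (simp_all add: \<rho>_def)
      then have "Des (Suc n) \<rho> = {1..n} \<inter> I"
        unfolding Des_def by auto
      then show ?thesis using Suc.prems by auto
    qed
    ultimately show ?thesis by blast
  qed
qed

lemma pm_less_trans: "u \<prec> v \<Longrightarrow> v \<prec> w \<Longrightarrow> u \<prec> w"
  by (auto simp: pm_less_def)

lemma pm_less_irrefl: "\<not> u \<prec> u"
  by (auto simp: pm_less_def)

lemma pairwise_iff_consecutive:
  assumes \<pi>: "\<pi> permutes {1..n}"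
  shows "(\<forall>a\<in>{1..n}. \<forall>b\<in>{1..n}. a < b \<longrightarrow>
       (\<pi> a < \<pi> b \<longrightarrow> g a \<prec> g b \<or> g a = g b \<and> g a > 0) \<and>
       (\<pi> a > \<pi> b \<longrightarrow> g a \<prec> g b \<or> g a = g b \<and> g a < 0)) \<longleftrightarrow>
    (\<forall>a\<in>{1..n-1}. g a \<prec> g (Suc a) \<or>
       g a = g (Suc a) \<and> (if a \<in> Des n \<pi> then g a < 0 else g a > 0))" (is "?P \<longleftrightarrow> ?C")
proof
  assume P: ?P
  show ?C
  proof
    fix a assume a: "a \<in> {1..n-1}"
    then have "a \<in> {1..n}" "Suc a \<in> {1..n}" by auto
    moreover have "\<pi> a \<noteq> \<pi> (Suc a)"
      using permutes_inj[OF \<pi>] by (metis injD n_not_Suc_n)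
    ultimately show "g a \<prec> g (Suc a) \<or>
       g a = g (Suc a) \<and> (if a \<in> Des n \<pi> then g a < 0 else g a > 0)"
      using P[rule_format, of a "Suc a"] a unfolding Des_def by (auto simp: neq_iff)
  qed
next
  assume C: ?C
  have main: "g a \<prec> g (a + Suc d) \<or> g a = g (a + Suc d) \<and>
      (g a > 0 \<and> \<pi> a < \<pi> (a + Suc d) \<or> g a < 0 \<and> \<pi> a > \<pi> (a + Suc d))"
    if "a \<ge> 1" "a + Suc d \<le> n" for a d
    using that(2)
  proof (induction d)
    case 0
    have "\<pi> a \<noteq> \<pi> (Suc a)"
      using permutes_inj[OF \<pi>] by (metis injD n_not_Suc_n)
    moreover have "a \<in> {1..n-1}" using 0 that(1) by auto
    ultimately show ?case
      using bspec[OF C, of a] by (auto simp: Des_def split: if_splits)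
  next
    case (Suc d)
    let ?b = "a + Suc d"
    have "\<pi> ?b \<noteq> \<pi> (Suc ?b)"
      using permutes_inj[OF \<pi>] by (metis injD n_not_Suc_n)
    moreover have b: "?b \<in> {1..n-1}" using Suc.prems by auto
    ultimately have step: "g ?b \<prec> g (Suc ?b) \<or> g ?b = g (Suc ?b) \<and>
        (g ?b > 0 \<and> \<pi> ?b < \<pi> (Suc ?b) \<or> g ?b < 0 \<and> \<pi> ?b > \<pi> (Suc ?b))"
      using bspec[OF C b] by (auto simp: Des_def split: if_splits)
    have "g a \<prec> g ?b \<or> g a = g ?b \<and>
      (g a > 0 \<and> \<pi> a < \<pi> ?b \<or> g a < 0 \<and> \<pi> a > \<pi> ?b)"
      using Suc by simp
    with step have "g a \<prec> g (Suc ?b) \<or> g a = g (Suc ?b) \<and>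
      (g a > 0 \<and> \<pi> a < \<pi> (Suc ?b) \<or> g a < 0 \<and> \<pi> a > \<pi> (Suc ?b))"
      using pm_less_trans[of "g a" "g ?b" "g (Suc ?b)"] by auto
    then show ?case by simp
  qed
  show ?P
  proof (intro ballI impI)
    fix a b assume ab: "a \<in> {1..n}" "b \<in> {1..n}" "a < b"
    then obtain d where "b = a + Suc d" using less_iff_Suc_add[of a b] by auto
    with ab main[of a d] show "(\<pi> a < \<pi> b \<longrightarrow> g a \<prec> g b \<or> g a = g b \<and> g a > 0) \<and>
       (\<pi> a > \<pi> b \<longrightarrow> g a \<prec> g b \<or> g a = g b \<and> g a < 0)" by auto
  qed
qed

lemma coeff_L_perm_Des:
  assumes \<pi>: "\<pi> permutes {1..n}"
  shows "coeff (L_perm q n \<pi>) m =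
    (\<Sum>g\<in>{g \<in> {1..n} \<rightarrow>\<^sub>E signed_alphabet. (\<forall>a\<in>{1..n-1}. g a \<prec> g (Suc a) \<or>
         g a = g (Suc a) \<and> (if a \<in> Des n \<pi> then g a < 0 else g a > 0)) \<and> mon_of n g = m}.
       \<Prod>i\<in>{1..n}. q ^ of_bool (g i < 0))"
proof -
  have inv: "inv \<pi> permutes {1..n}" using \<pi> by (rule permutes_inv)
  have comp: "(\<lambda>x. g (\<sigma> x)) \<in> {1..n} \<rightarrow>\<^sub>E signed_alphabet"
    if "\<sigma> permutes {1..n}" "g \<in> {1..n} \<rightarrow>\<^sub>E signed_alphabet" for g \<sigma>
  proof (rule PiE_I)
    fix x assume "x \<in> {1..n}"
    then have "\<sigma> x \<in> {1..n}" by (simp only: permutes_in_image[OF that(1)])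
    with that(2) show "g (\<sigma> x) \<in> signed_alphabet" by (rule PiE_mem)
  next
    fix x assume x: "x \<notin> {1..n}"
    then have "\<sigma> x = x" by (rule permutes_not_in[OF that(1)])
    with PiE_arb[OF that(2) x] show "g (\<sigma> x) = undefined" by (simp only:)
  qed
  have mon: "mon_of n (\<lambda>x. g (\<sigma> x)) = mon_of n g" if "\<sigma> permutes {1..n}" for g \<sigma>
    unfolding mon_of_def
    by (rule sum.permute[OF that,
          of "\<lambda>i. Poly_Mapping.single (nat \<bar>g i\<bar>) (1::nat)", unfolded o_def, symmetric])
  have pr: "(\<Prod>i\<in>{1..n}. q ^ of_bool (g (\<sigma> i) < 0)) = (\<Prod>i\<in>{1..n}. q ^ of_bool (g i < 0))"
    if "\<sigma> permutes {1..n}" for g :: "nat \<Rightarrow> int" and \<sigma>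
    by (rule prod.permute[OF that, of "\<lambda>i. q ^ of_bool (g i < 0)", unfolded o_def, symmetric])
  have inv1: "(\<lambda>x. f (\<pi> (inv \<pi> x))) = f" and inv2: "(\<lambda>x. f (inv \<pi> (\<pi> x))) = f"
    for f :: "nat \<Rightarrow> int"
    by (simp_all only: permutes_inverses[OF \<pi>])
  have cond: "f \<in> enriched_partitions n \<pi> \<longleftrightarrow> f \<in> {1..n} \<rightarrow>\<^sub>E signed_alphabet \<and>
      (\<forall>a\<in>{1..n-1}. f (\<pi> a) \<prec> f (\<pi> (Suc a)) \<or> f (\<pi> a) = f (\<pi> (Suc a)) \<and>
         (if a \<in> Des n \<pi> then f (\<pi> a) < 0 else f (\<pi> a) > 0))" for f
    unfolding enriched_partitions_def mem_Collect_eq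
    by (rule conj_cong[OF refl pairwise_iff_consecutive[OF \<pi>, of "\<lambda>x. f (\<pi> x)"]])
  show ?thesis
    unfolding L_perm.rep_eq
  proof (rule sum.reindex_bij_witness[where i = "\<lambda>g x. g (inv \<pi> x)" and j = "\<lambda>f x. f (\<pi> x)"],
      goal_cases)
    case (1 f)
    show ?case by (rule inv1)
  next
    case (2 f)
    then show ?case
      unfolding mem_Collect_eq cond mon[OF \<pi>]
      by (elim conjE) (intro conjI comp[OF \<pi>], assumption+)
  next
    case (3 g)
    show ?case by (rule inv2)
  next
    case (4 g)
    then show ?case
      unfolding mem_Collect_eq cond mon[OF inv] permutes_inverses[OF \<pi>]
      by (elim conjE) (intro conjI comp[OF inv], assumption+)
  next
    case (5 f)
    show ?case by (rule pr[OF \<pi>])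
  qed
qed

lemma L_perm_eq_Lq:
  assumes "\<pi> permutes {1..n}" "Des n \<pi> = I"
  shows "L_perm q n \<pi> = Lq q n I"
proof -
  define \<sigma> where "\<sigma> = (SOME \<pi>. \<pi> permutes {1..n} \<and> Des n \<pi> = I)"
  have "\<sigma> permutes {1..n} \<and> Des n \<sigma> = I"
    unfolding \<sigma>_def by (rule someI[of _ \<pi>]) (use assms in blast)
  then have \<sigma>: "\<sigma> permutes {1..n}" and D: "Des n \<sigma> = Des n \<pi>"
    using assms(2) by blast+
  have "coeff (L_perm q n \<pi>) m = coeff (L_perm q n \<sigma>) m" for m
    unfolding coeff_L_perm_Des[OF assms(1)] coeff_L_perm_Des[OF \<sigma>] D by (rule refl)
  then show ?thesis
    unfolding Lq_def \<sigma>_def[symmetric] coeff_inject[symmetric] by (rule ext)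
qed

end

theory Submission
  imports Defs
begin

text \<open>
  The coefficient of \<open>L\<^sub>n\<^sub>,\<^sub>I\<close> at the monomial of a sorted word depends only on \<open>I\<close> and on the set \<open>J\<close>
  of ascents of the word: it is a sum over sign patterns, computed by a transfer matrix whose
  state is the current sign. Let \<open>A\<close> be the matrix of these coefficients, indexed by \<open>I\<close> and \<open>J\<close>,
  and let \<open>B\<close> be \<open>1 + q\<close> times the part of \<open>A\<close> that starts with a positive sign. With
  \<open>s\<^sub>k = 1 - q + \<dots> + (-q)^k\<close>, splitting \<open>(-q)^k A + s\<^sub>k\<^sub>-\<^sub>1 B\<close> by the first entries of \<open>I\<close> and \<open>J\<close> and
  subtracting block rows leaves a triangular matrix with the diagonal blocks
  \<open>(-q)^(k+1) A' + s\<^sub>k B'\<close> and \<open>s\<^sub>k (1 + q) A'\<close> of the next smaller size. As \<open>s\<^sub>k \<noteq> 0\<close> for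
  \<open>q \<noteq> \<plusminus>1\<close>, all these matrices are invertible; so the coefficients of the \<open>L\<^sub>n\<^sub>,\<^sub>I\<close> in
  the monomial basis form an invertible matrix in each degree.
\<close>

subsection \<open>The transfer matrix and its invertibility\<close>

text \<open>The bool lists \<open>is\<close> and \<open>js\<close> are the indicator lists of \<open>I\<close> and \<open>J\<close>; in lists of signs, \<open>True\<close> stands for a negative letter.\<close>

definition sign_ok :: "bool \<Rightarrow> bool \<Rightarrow> bool \<Rightarrow> bool \<Rightarrow> bool" where
  "sign_ok i j s t \<longleftrightarrow> j \<or> (s \<and> \<not> t) \<or> (s = t \<and> s = i)"

text \<open>The absolute values of the letters enter only through \<open>js\<close>. A word with
  \<open>n\<close> letters has \<open>n - 1\<close> adjacent pairs, so the list of signs is one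
  longer than \<open>is\<close> and \<open>js\<close>; lists of other lengths are rejected.\<close>

fun sign_words :: "bool list \<Rightarrow> bool list \<Rightarrow> bool list \<Rightarrow> bool" where
  "sign_words [] [] [s] \<longleftrightarrow> True"
| "sign_words (i # is) (j # js) (s # t # \<sigma>) \<longleftrightarrow> sign_ok i j s t \<and> sign_words is js (t # \<sigma>)"
| "sign_words _ _ _ \<longleftrightarrow> False"

definition sign_weight :: "real \<Rightarrow> bool list \<Rightarrow> real" where
  "sign_weight q \<sigma> = (\<Prod>s\<leftarrow>\<sigma>. q ^ of_bool s)"

text \<open>The transfer-matrix recursion whose state is the current sign \<open>s\<close>. It adds
  up the weights of all admissible sign lists that begin with \<open>s\<close>.\<close>

fun transfer_sum :: "real \<Rightarrow> bool \<Rightarrow> bool list \<Rightarrow> bool list \<Rightarrow> real" where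
  "transfer_sum q s [] [] = q ^ of_bool s"
| "transfer_sum q s (i # is) (j # js) =
     q ^ of_bool s * (\<Sum>t\<in>{t. sign_ok i j s t}. transfer_sum q t is js)"
| "transfer_sum q s _ _ = 0"

lemma sign_words_length: "sign_words is js \<sigma> \<Longrightarrow> length \<sigma> = Suc (length is)"
  by (induction "is" js \<sigma> rule: sign_words.induct) auto

lemma finite_sign_words: "finite {\<sigma>. sign_words is js \<sigma>}"
proof (rule finite_subset)
  show "{\<sigma>. sign_words is js \<sigma>} \<subseteq> {\<sigma>. set \<sigma> \<subseteq> UNIV \<and> length \<sigma> = Suc (length is)}"
    by (auto dest: sign_words_length)
  show "finite {\<sigma> :: bool list. set \<sigma> \<subseteq> UNIV \<and> length \<sigma> = Suc (length is)}"
    by (rule finite_lists_length_eq) simp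
qed

lemma sign_words_iff:
  assumes "length js = length is"
  shows "sign_words is js \<sigma> \<longleftrightarrow> length \<sigma> = Suc (length is) \<and>
    (\<forall>a < length is. sign_ok (is ! a) (js ! a) (\<sigma> ! a) (\<sigma> ! Suc a))"
  using assms
proof (induction "is" js \<sigma> rule: sign_words.induct)
  case (2 i "is" j js s t \<sigma>)
  then show ?case by (simp add: All_less_Suc2 conj_ac)
qed (auto simp: length_Suc_conv)

text \<open>Splitting by the second sign \<open>t\<close> partitions the admissible lists, and the
  weight of the first sign factors out of each part.\<close>

lemma sum_sign_weight_Cons:
  "length js = length is \<Longrightarrow>
   (\<Sum>\<sigma>\<in>{\<sigma>. sign_words is js (s # \<sigma>)}. sign_weight q (s # \<sigma>)) = transfer_sum q s is js"
proof (induction "is" js arbitrary: s rule: list_induct2')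
  case 1
  have "{\<sigma>. sign_words [] [] (s # \<sigma>)} = {[]}"
    by (auto simp: neq_Nil_conv elim: sign_words.elims)
  then show ?case by (simp add: sign_weight_def)
next
  case (4 i "is" j js)
  have fin: "finite {\<sigma>. sign_words is js (t # \<sigma>)}" for t
    using finite_vimageI[OF finite_sign_words, of "Cons t" "is" js] by (simp add: vimage_def)
  have "{\<sigma>. sign_words (i # is) (j # js) (s # \<sigma>)} =
      (\<Union>t\<in>{t. sign_ok i j s t}. Cons t ` {\<sigma>. sign_words is js (t # \<sigma>)})"
  proof (intro equalityI subsetI)
    fix \<sigma> assume "\<sigma> \<in> {\<sigma>. sign_words (i # is) (j # js) (s # \<sigma>)}"
    then show "\<sigma> \<in> (\<Union>t\<in>{t. sign_ok i j s t}. Cons t ` {\<sigma>. sign_words is js (t # \<sigma>)})"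
      by (cases \<sigma>) auto
  qed auto
  then have "(\<Sum>\<sigma>\<in>{\<sigma>. sign_words (i # is) (j # js) (s # \<sigma>)}. sign_weight q (s # \<sigma>)) =
      (\<Sum>t\<in>{t. sign_ok i j s t}. \<Sum>\<sigma>\<in>Cons t ` {\<sigma>. sign_words is js (t # \<sigma>)}.
        sign_weight q (s # \<sigma>))"
    by (simp only:) (rule sum.UNION_disjoint, use fin in auto)
  also have "\<dots> = (\<Sum>t\<in>{t. sign_ok i j s t}. q ^ of_bool s * transfer_sum q t is js)"
  proof (rule sum.cong[OF refl])
    fix t
    have "(\<Sum>\<sigma>\<in>Cons t ` {\<sigma>. sign_words is js (t # \<sigma>)}. sign_weight q (s # \<sigma>)) =
        q ^ of_bool s * (\<Sum>\<sigma>\<in>{\<sigma>. sign_words is js (t # \<sigma>)}. sign_weight q (t # \<sigma>))"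
      by (subst sum.reindex) (auto simp: sum_distrib_left sign_weight_def)
    with 4 show "(\<Sum>\<sigma>\<in>Cons t ` {\<sigma>. sign_words is js (t # \<sigma>)}. sign_weight q (s # \<sigma>)) =
        q ^ of_bool s * transfer_sum q t is js" by simp
  qed
  finally show ?case by (simp add: sum_distrib_left)
qed auto

lemma sum_sign_weight:
  assumes "length js = length is"
  shows "(\<Sum>\<sigma>\<in>{\<sigma>. sign_words is js \<sigma>}. sign_weight q \<sigma>) =
    transfer_sum q True is js + transfer_sum q False is js"
proof -
  have fin: "finite {\<sigma>. sign_words is js (t # \<sigma>)}" for t
    using finite_vimageI[OF finite_sign_words, of "Cons t" "is" js] by (simp add: vimage_def)
  have "{\<sigma>. sign_words is js \<sigma>} = Cons True ` {\<sigma>. sign_words is js (True # \<sigma>)} \<union>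
      Cons False ` {\<sigma>. sign_words is js (False # \<sigma>)}" (is "_ = ?X \<union> ?Y")
  proof (intro equalityI subsetI)
    fix \<sigma> assume *: "\<sigma> \<in> {\<sigma>. sign_words is js \<sigma>}"
    then obtain s \<tau> where "\<sigma> = s # \<tau>"
      using sign_words_iff[OF assms, of \<sigma>] by (cases \<sigma>) auto
    with * show "\<sigma> \<in> ?X \<union> ?Y"
      by (cases s) auto
  qed auto
  then have "(\<Sum>\<sigma>\<in>{\<sigma>. sign_words is js \<sigma>}. sign_weight q \<sigma>) =
      sum (sign_weight q) ?X + sum (sign_weight q) ?Y"
    by (simp only:) (rule sum.union_disjoint, use fin in auto)
  also have "sum (sign_weight q) ?X = transfer_sum q True is js"
    by (subst sum.reindex) (simp_all add: sum_sign_weight_Cons[OF assms])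
  also have "sum (sign_weight q) ?Y = transfer_sum q False is js"
    by (subst sum.reindex) (simp_all add: sum_sign_weight_Cons[OF assms])
  finally show ?thesis .
qed

text \<open>The sum is empty for \<open>k = 0\<close>, so \<open>pencil q 0\<close> is the
  coefficient matrix itself. Larger \<open>k\<close> are carried along because eliminating one block
  turns \<open>k\<close> into \<open>Suc k\<close>.\<close>

definition pencil :: "real \<Rightarrow> nat \<Rightarrow> bool list \<Rightarrow> bool list \<Rightarrow> real" where
  "pencil q k is js = (- q) ^ k * (transfer_sum q True is js + transfer_sum q False is js) +
     (\<Sum>i<k. (- q) ^ i) * ((1 + q) * transfer_sum q False is js)"

lemma sign_ok_sets:
  "{t. sign_ok i True s t} = {True, False}"
  "{t. sign_ok True False True t} = {True, False}"
  "{t. sign_ok True False False t} = {}"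
  "{t. sign_ok False False s t} = {False}"
  by (auto simp: sign_ok_def)

lemma pencil_Nil: "pencil q k [] [] = (1 + q) * (\<Sum>i<Suc k. (- q) ^ i)"
  by (simp add: pencil_def algebra_simps)

text \<open>After a strict ascent the next sign is free, so the starts with a negative and a
  positive sign contribute \<open>q\<close> and 1 times the same smaller entry. The outcome does not
  depend on \<open>i\<close>, which makes the two blocks in these columns equal.\<close>

lemma pencil_Cons_True:
  "pencil q k (i # is) (True # js) = (\<Sum>i<Suc k. (- q) ^ i) * (1 + q) * pencil q 0 is js"
  by (simp add: pencil_def sign_ok_sets algebra_simps)

text \<open>At a descent without an ascent no continuation of a positive sign is allowed, while a
  negative one may continue freely.\<close>

lemma pencil_True_False:
  "pencil q k (True # is) (False # js) = (- q) ^ k * q * pencil q 0 is js"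
  by (simp add: pencil_def sign_ok_sets algebra_simps)

text \<open>Here the next sign must be positive, which leaves only the part of the smaller matrix
  that starts with a positive sign. Written this way, the block differs from the one for
  \<open>True # is\<close> exactly by \<open>pencil q (Suc k)\<close>.\<close>

lemma pencil_False_False:
  "pencil q k (False # is) (False # js) =
    pencil q (Suc k) is js + (- q) ^ k * q * pencil q 0 is js"
  by (simp add: pencil_def sign_ok_sets algebra_simps)

text \<open>If this geometric sum vanished, \<open>- q\<close> would be a real root of unity, and so
  \<open>q\<close> would have absolute value 1.\<close>

lemma sum_minus_powers_nonzero:
  fixes q :: real
  assumes "q \<notin> {-1, 1}"
  shows "(\<Sum>i<Suc k. (- q) ^ i) \<noteq> 0"
proof
  assume "(\<Sum>i<Suc k. (- q) ^ i) = 0"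
  then have "(- q) ^ Suc k = 1"
    using power_diff_1_eq[of "- q" "Suc k"] by simp
  then have "\<bar>- q\<bar> ^ Suc k = 1"
    by (metis abs_one power_abs)
  then have "\<bar>q\<bar> = 1"
    by (metis abs_ge_zero abs_minus_cancel power_eq_1_iff nat.distinct(1) abs_idempotent real_norm_def)
  with assms show False by auto
qed

section \<open>Inverting the pencil by block elimination\<close>

abbreviation lists_of :: "nat \<Rightarrow> bool list set" where
  "lists_of m \<equiv> {xs. length xs = m}"

lemma finite_lists_of: "finite (lists_of m)"
  using finite_lists_length_eq[of "UNIV :: bool set" m] by simp

lemma sum_lists_of_Suc:
  "(\<Sum>xs\<in>lists_of (Suc m). f xs) = (\<Sum>xs\<in>lists_of m. f (False # xs) + f (True # xs))"
proof -
  have "lists_of (Suc m) = Cons False ` lists_of m \<union> Cons True ` lists_of m"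
    by (auto simp: length_Suc_conv image_iff)
  then have "(\<Sum>xs\<in>lists_of (Suc m). f xs) =
      sum f (Cons False ` lists_of m) + sum f (Cons True ` lists_of m)"
    by (simp only:) (rule sum.union_disjoint, use finite_lists_of in auto)
  then show ?thesis
    by (simp add: sum.reindex sum.distrib)
qed

lemma sum_pencil_True:
  "(\<Sum>xs\<in>lists_of (Suc m). w xs * pencil q k xs (True # js)) =
    (\<Sum>i<Suc k. (- q) ^ i) * (1 + q) *
      (\<Sum>xs\<in>lists_of m. (w (False # xs) + w (True # xs)) * pencil q 0 xs js)"
  by (simp only: sum_lists_of_Suc pencil_Cons_True sum_distrib_left)
    (rule sum.cong, simp_all add: algebra_simps)

text \<open>Together with \<open>sum_pencil_True\<close> this shows that the system is block
  triangular in the unknowns \<open>w (False # xs)\<close> and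
  \<open>w (False # xs) + w (True # xs)\<close>.\<close>

lemma sum_pencil_False:
  "(\<Sum>xs\<in>lists_of (Suc m). w xs * pencil q k xs (False # js)) =
    (\<Sum>xs\<in>lists_of m. w (False # xs) * pencil q (Suc k) xs js) +
    (- q) ^ k * q * (\<Sum>xs\<in>lists_of m. (w (False # xs) + w (True # xs)) * pencil q 0 xs js)"
  by (simp only: sum_lists_of_Suc pencil_True_False pencil_False_False sum_distrib_left
      sum.distrib[symmetric]) (rule sum.cong, simp_all add: algebra_simps)

text \<open>The vector \<open>w\<close> multiplies the rows, since the rows will belong to the
  functions whose linear relations are studied. The induction needs all \<open>k\<close> at
  once.\<close>

lemma pencil_injective:
  assumes q: "q \<notin> {-1, 1}"
    and "\<And>js. length js = m \<Longrightarrow> (\<Sum>xs\<in>lists_of m. w xs * pencil q k xs js) = 0"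
    and "length xs = m"
  shows "w xs = 0"
  using assms(2,3)
proof (induction m arbitrary: k w xs)
  case 0
  from 0(1)[of "[]"] have "w [] * ((1 + q) * (\<Sum>i<Suc k. (- q) ^ i)) = 0"
    by (simp add: pencil_Nil)
  with q 0(2) sum_minus_powers_nonzero[OF q, of k] show ?case by auto
next
  case (Suc m)
  \<comment> \<open>The columns that start with \<open>True\<close> see only the sum of the two
    halves of \<open>w\<close>, with a nonzero factor.\<close>
  have u: "(\<Sum>xs\<in>lists_of m. (w (False # xs) + w (True # xs)) * pencil q 0 xs js) = 0"
    if "length js = m" for js
    using Suc.prems(1)[of "True # js"] that q sum_minus_powers_nonzero[OF q, of k]
    by (auto simp: sum_pencil_True simp del: sum.lessThan_Suc)
  \<comment> \<open>In the columns that start with \<open>False\<close> the contribution of that sum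
    now drops out, and the pencil with \<open>Suc k\<close> remains.\<close>
  have "(\<Sum>xs\<in>lists_of m. w (False # xs) * pencil q (Suc k) xs js) = 0"
    if "length js = m" for js
    using Suc.prems(1)[of "False # js"] that u[OF that] by (simp add: sum_pencil_False)
  then have "w (False # ys) = 0" if "length ys = m" for ys
    using Suc.IH[of "\<lambda>ys. w (False # ys)"] that by blast
  moreover have "w (False # ys) + w (True # ys) = 0" if "length ys = m" for ys
    using Suc.IH[of "\<lambda>ys. w (False # ys) + w (True # ys)"] that u by blast
  moreover obtain y ys where "xs = y # ys" "length ys = m"
    using Suc.prems(2) by (auto simp: length_Suc_conv)
  ultimately show ?case by (cases y) force+
qed

lemma pencil_surjective:
  assumes q: "q \<notin> {-1, 1}"
  shows "\<exists>w. \<forall>js. length js = m \<longrightarrow> (\<Sum>xs\<in>lists_of m. w xs * pencil q k xs js) = v js"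
proof (induction m arbitrary: k v)
  case 0
  show ?case
    using q sum_minus_powers_nonzero[OF q, of k]
    by (intro exI[of _ "\<lambda>_. v [] / pencil q k [] []"]) (simp add: pencil_Nil del: sum.lessThan_Suc)
next
  case (Suc m)
  let ?s = "\<Sum>i<Suc k. (- q) ^ i"
  \<comment> \<open>Back substitution: the columns with \<open>True\<close> determine the sum
    \<open>u\<close> of the two halves of the solution, and then those with \<open>False\<close>
    determine its half \<open>w0\<close>.\<close>
  obtain u where u: "\<And>js. length js = m \<Longrightarrow>
      (\<Sum>xs\<in>lists_of m. u xs * pencil q 0 xs js) = v (True # js) / (?s * (1 + q))"
    using Suc.IH[of 0 "\<lambda>js. v (True # js) / (?s * (1 + q))"] by blast
  obtain w0 where w0: "\<And>js. length js = m \<Longrightarrow>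
      (\<Sum>xs\<in>lists_of m. w0 xs * pencil q (Suc k) xs js) =
      v (False # js) - (- q) ^ k * q * (\<Sum>xs\<in>lists_of m. u xs * pencil q 0 xs js)"
    using Suc.IH[of "Suc k" "\<lambda>js. v (False # js) -
      (- q) ^ k * q * (\<Sum>xs\<in>lists_of m. u xs * pencil q 0 xs js)"] by blast
  define w where "w xs = (if hd xs then u (tl xs) - w0 (tl xs) else w0 (tl xs))" for xs
  have "(\<Sum>xs\<in>lists_of (Suc m). w xs * pencil q k xs js) = v js" if js_len: "length js = Suc m" for js
  proof -
    obtain j ys where js: "js = j # ys" and ys: "length ys = m"
      using js_len by (auto simp: length_Suc_conv)
    have w: "w (False # xs) = w0 xs" "w (False # xs) + w (True # xs) = u xs" for xs
      by (simp_all add: w_def)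
    show ?thesis
    proof (cases j)
      case True
      then show ?thesis
        using q sum_minus_powers_nonzero[OF q, of k]
        by (simp add: js sum_pencil_True w(2) u[OF ys] del: sum.lessThan_Suc)
    next
      case False
      then have "js = False # ys" using js by simp
      then show ?thesis
        by (simp only: sum_pencil_False w(2)) (simp add: w(1) w0[OF ys])
    qed
  qed
  then show ?case by blast
qed

subsection \<open>Coefficients as transfer sums\<close>

definition word_mon :: "nat list \<Rightarrow> (nat \<Rightarrow>\<^sub>0 nat)" where
  "word_mon xs = (\<Sum>x\<leftarrow>xs. Poly_Mapping.single x 1)"

lemma word_mon_simps [simp]:
  "word_mon [] = 0" "word_mon (x # xs) = Poly_Mapping.single x 1 + word_mon xs"
  "word_mon (xs @ ys) = word_mon xs + word_mon ys"
  by (simp_all add: word_mon_def)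

lemma lookup_word_mon: "Poly_Mapping.lookup (word_mon xs) v = count (mset xs) v"
  by (induction xs) (auto simp: lookup_add lookup_single when_def)

lemma word_mon_inject_sorted:
  assumes "sorted xs" "sorted ys" "word_mon xs = word_mon ys"
  shows "xs = ys"
proof -
  have "mset xs = mset ys"
    using assms(3) by (metis lookup_word_mon multiset_eqI)
  then show ?thesis
    using assms(1,2) by (metis properties_for_sort)
qed

lemma mon_of_eq_word_mon: "mon_of n g = word_mon (map (\<lambda>a. nat \<bar>g (Suc a)\<bar>) [0..<n])"
  unfolding mon_of_def by (induction n) simp_all

lemma mon_degree_eq_sum:
  assumes "finite K" "Poly_Mapping.keys m \<subseteq> K"
  shows "mon_degree m = (\<Sum>i\<in>K. Poly_Mapping.lookup m i)"
  unfolding mon_degree_def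
  by (rule sum.mono_neutral_left) (use assms in \<open>auto simp: in_keys_iff\<close>)

lemma mon_degree_add: "mon_degree (m + m') = mon_degree m + mon_degree m'"
proof -
  let ?K = "Poly_Mapping.keys m \<union> Poly_Mapping.keys m'"
  have "mon_degree x = (\<Sum>i\<in>?K. Poly_Mapping.lookup x i)" if "x \<in> {m, m', m + m'}" for x
    by (rule mon_degree_eq_sum) (use that keys_add[of m m'] in auto)
  then show ?thesis
    by (simp add: lookup_add sum.distrib)
qed

lemma mon_degree_word_mon [simp]: "mon_degree (word_mon xs) = length xs"
  by (induction xs) (simp_all add: mon_degree_add, simp_all add: mon_degree_def)

section \<open>Ascents, descent sets and signed words\<close>

fun ascents :: "nat list \<Rightarrow> bool list" where
  "ascents (x # y # zs) = (x < y) # ascents (y # zs)"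
| "ascents _ = []"

lemma length_ascents [simp]: "length (ascents xs) = length xs - 1"
  by (induction xs rule: ascents.induct) auto

lemma nth_ascents: "Suc a < length xs \<Longrightarrow> ascents xs ! a \<longleftrightarrow> xs ! a < xs ! Suc a"
  by (induction xs arbitrary: a rule: ascents.induct) (auto simp: nth_Cons split: nat.splits)

lemma ascents_map:
  assumes "strict_mono_on S f" "set xs \<subseteq> S"
  shows "ascents (map f xs) = ascents xs"
  using assms(2) by (induction xs rule: ascents.induct)
    (auto simp: strict_mono_on_less[OF assms(1)])

definition desc_list :: "nat \<Rightarrow> nat set \<Rightarrow> bool list" where
  "desc_list n I = map (\<lambda>a. Suc a \<in> I) [0..<n - 1]"

lemma length_desc_list [simp]: "length (desc_list n I) = n - 1"
  by (simp add: desc_list_def)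

lemma nth_desc_list: "a < n - 1 \<Longrightarrow> desc_list n I ! a \<longleftrightarrow> Suc a \<in> I"
  by (simp add: desc_list_def)

lemma Collect_desc_list:
  "I \<in> Pow {1..n-1} \<Longrightarrow> {a \<in> {1..n-1}. desc_list n I ! (a - 1)} = I"
  by (auto simp: nth_desc_list Suc_le_eq) (subst nth_desc_list; force)

text \<open>Positions are counted from 1 as in the domain of the maps, whereas list entries are
  counted from 0. The restriction makes the map \<open>undefined\<close> outside the domain, as
  extensionality requires.\<close>

definition signed_word :: "nat list \<Rightarrow> bool list \<Rightarrow> nat \<Rightarrow> int" where
  "signed_word xs \<sigma> = (\<lambda>a\<in>{1..length xs}.
     if \<sigma> ! (a - 1) then - int (xs ! (a - 1)) else int (xs ! (a - 1)))"

text \<open>A contributing map has weakly increasing absolute values, so these must spell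
  \<open>xs\<close> and only the signs remain to be chosen. The sum over the signs is the transfer
  sum.\<close>

lemma coeff_Lq_word:
  assumes xs: "sorted xs" "0 \<notin> set xs" "length xs = n" "n \<noteq> 0" and I: "I \<subseteq> {1..n-1}"
  shows "coeff (Lq q n I) (word_mon xs) = pencil q 0 (desc_list n I) (ascents xs)"
proof -
  obtain \<pi> where \<pi>: "\<pi> permutes {1..n}" "Des n \<pi> = I"
    using ex_perm_Des[OF I] by blast
  define step where "step g a \<longleftrightarrow> g a \<prec> g (Suc a) \<or>
         g a = g (Suc a) \<and> (if a \<in> I then g a < 0 else g a > 0)" for g :: "nat \<Rightarrow> int" and a
  define G where "G = {g \<in> {1..n} \<rightarrow>\<^sub>E signed_alphabet. (\<forall>a\<in>{1..n-1}. step g a) \<and>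
      mon_of n g = word_mon xs}"
  define \<Sigma> where "\<Sigma> = {\<sigma>. sign_words (desc_list n I) (ascents xs) \<sigma>}"
  have pos: "xs ! a > 0" if "a < n" for a
    using that xs by (metis gr0I nth_mem)
  have \<Sigma>_iff: "\<sigma> \<in> \<Sigma> \<longleftrightarrow> length \<sigma> = n \<and>
      (\<forall>a < n - 1. sign_ok (Suc a \<in> I) (xs ! a < xs ! Suc a) (\<sigma> ! a) (\<sigma> ! Suc a))" for \<sigma>
    using xs(3,4) unfolding \<Sigma>_def by (auto simp: sign_words_iff nth_desc_list nth_ascents)
  \<comment> \<open>The absolute values of \<open>g\<close> form a sorted word with the same
    monomial as \<open>xs\<close>, and a sorted word is determined by its monomial.\<close>
  have abs_G: "nat \<bar>g (Suc a)\<bar> = xs ! a" if "g \<in> G" "a < n" for g a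
  proof -
    let ?ys = "map (\<lambda>a. nat \<bar>g (Suc a)\<bar>) [0..<n]"
    have "nat \<bar>g (Suc b)\<bar> \<le> nat \<bar>g (Suc (Suc b))\<bar>" if "Suc b < n" for b
    proof -
      have "step g (Suc b)"
        using \<open>g \<in> G\<close> that by (auto simp: G_def)
      then show ?thesis
        by (auto simp: step_def pm_less_def)
    qed
    then have "sorted ?ys"
      by (simp add: sorted_iff_nth_Suc)
    moreover have "word_mon ?ys = word_mon xs"
      using \<open>g \<in> G\<close> by (simp add: G_def mon_of_eq_word_mon)
    ultimately have "?ys = xs"
      using word_mon_inject_sorted[OF _ xs(1)] by blast
    then show ?thesis
      using that(2) by (metis add_0 diff_zero length_upt nth_map nth_upt)
  qed
  \<comment> \<open>A rise in absolute value allows any signs. At equal absolute values, minus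
    followed by plus is an increase in the signed order; otherwise the letter repeats and its sign
    is prescribed by the descent set.\<close>
  have step_iff: "step g (Suc a) \<longleftrightarrow>
      sign_ok (Suc a \<in> I) (xs ! a < xs ! Suc a) (g (Suc a) < 0) (g (Suc (Suc a)) < 0)"
    if "nat \<bar>g (Suc a)\<bar> = xs ! a" "nat \<bar>g (Suc (Suc a))\<bar> = xs ! Suc a" "a < n - 1" for g a
  proof -
    have "xs ! a \<le> xs ! Suc a"
      using xs that(3) by (simp add: sorted_iff_nth_Suc)
    moreover have "xs ! a > 0" "xs ! Suc a > 0"
      using pos that(3) by auto
    ultimately show ?thesis
      using that(1,2) unfolding step_def pm_less_def sign_ok_def by (auto split: if_splits)
  qed
  have sw: "signed_word xs \<sigma> (Suc a) = (if \<sigma> ! a then - int (xs ! a) else int (xs ! a))"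
    if "a < n" for \<sigma> a
    using that xs(3) by (simp add: signed_word_def)
  have sw_abs: "nat \<bar>signed_word xs \<sigma> (Suc a)\<bar> = xs ! a" if "a < n" for \<sigma> a
    using that by (simp add: sw)
  have sw_neg: "signed_word xs \<sigma> (Suc a) < 0 \<longleftrightarrow> \<sigma> ! a" if "a < n" for \<sigma> a
    using that pos[OF that] by (simp add: sw)
  have "coeff (Lq q n I) (word_mon xs) = (\<Sum>g\<in>G. \<Prod>i\<in>{1..n}. q ^ of_bool (g i < 0))"
    unfolding L_perm_eq_Lq[OF \<pi>, symmetric] coeff_L_perm_Des[OF \<pi>(1)] G_def step_def \<pi>(2) ..
  also have "\<dots> = (\<Sum>\<sigma>\<in>\<Sigma>. sign_weight q \<sigma>)"
  proof (rule sum.reindex_bij_witness[where i = "signed_word xs"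
        and j = "\<lambda>g. map (\<lambda>a. g (Suc a) < 0) [0..<n]"])
    fix g assume g: "g \<in> G"
    show "signed_word xs (map (\<lambda>a. g (Suc a) < 0) [0..<n]) = g"
    proof
      fix a
      show "signed_word xs (map (\<lambda>a. g (Suc a) < 0) [0..<n]) a = g a"
      proof (cases "a \<in> {1..n}")
        case True
        then obtain b where b: "a = Suc b" "b < n" by (cases a) auto
        with abs_G[OF g b(2)] pos[OF b(2)] show ?thesis by (auto simp: sw)
      next
        case False
        with g xs(3) show ?thesis
          by (auto simp: G_def signed_word_def PiE_def extensional_def)
      qed
    qed
    have "step g (Suc a)" if "a < n - 1" for a
      using g that by (auto simp: G_def)
    then show "map (\<lambda>a. g (Suc a) < 0) [0..<n] \<in> \<Sigma>"
      using step_iff[OF abs_G[OF g] abs_G[OF g]] unfolding \<Sigma>_iff by auto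
    show "sign_weight q (map (\<lambda>a. g (Suc a) < 0) [0..<n]) = (\<Prod>i\<in>{1..n}. q ^ of_bool (g i < 0))"
      unfolding sign_weight_def by (induction n) simp_all
  next
    fix \<sigma> assume \<sigma>: "\<sigma> \<in> \<Sigma>"
    then have len: "length \<sigma> = n" by (simp add: \<Sigma>_iff)
    show "map (\<lambda>a. signed_word xs \<sigma> (Suc a) < 0) [0..<n] = \<sigma>"
      by (rule nth_equalityI) (simp_all add: len sw_neg)
    have "step (signed_word xs \<sigma>) a" if a: "a \<in> {1..n-1}" for a
    proof -
      obtain b where b: "a = Suc b" "b < n - 1" using a by (cases a) auto
      show ?thesis
        unfolding b(1) by (subst step_iff) (use \<sigma> b(2) in \<open>auto simp: sw_abs sw_neg \<Sigma>_iff\<close>)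
    qed
    moreover have "signed_word xs \<sigma> \<in> {1..n} \<rightarrow>\<^sub>E signed_alphabet"
      using xs(3) pos by (auto simp: signed_word_def signed_alphabet_def PiE_def Pi_def)
    moreover have "map (\<lambda>a. nat \<bar>signed_word xs \<sigma> (Suc a)\<bar>) [0..<n] = xs"
      by (rule nth_equalityI) (simp_all add: xs(3) sw_abs)
    ultimately show "signed_word xs \<sigma> \<in> G"
      by (simp add: G_def mon_of_eq_word_mon)
  qed
  also have "\<dots> = pencil q 0 (desc_list n I) (ascents xs)"
    unfolding \<Sigma>_def by (subst sum_sign_weight) (simp_all add: xs(3) pencil_def)
  finally show ?thesis .
qed

text \<open>Degree 0 stands apart: the empty map has weight 1, whereas
  \<open>pencil q 0 [] []\<close> is \<open>1 + q\<close> because it sums over the sign of one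
  letter.\<close>

lemma coeff_Lq_0: "coeff (Lq q 0 {}) 0 = 1"
proof -
  have "Des 0 id = {}" by (simp add: Des_def)
  then have "Lq q 0 {} = L_perm q 0 id"
    by (intro L_perm_eq_Lq[symmetric]) (simp_all add: permutes_id)
  then show ?thesis
    by (simp add: coeff_L_perm_Des permutes_id mon_of_def)
qed

text \<open>Homogeneity holds for whichever permutation the choice operator selects, since every map
  on \<open>n\<close> points has a monomial of degree \<open>n\<close>.\<close>

lemma mon_degree_coeff_Lq:
  assumes "coeff (Lq q n I) m \<noteq> 0"
  shows "mon_degree m = n"
proof -
  obtain \<pi> where "Lq q n I = L_perm q n \<pi>"
    by (simp add: Lq_def)
  have "{f \<in> enriched_partitions n \<pi>. mon_of n f = m} \<noteq> {}"
  proof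
    assume "{f \<in> enriched_partitions n \<pi>. mon_of n f = m} = {}"
    with assms show False
      unfolding \<open>Lq q n I = L_perm q n \<pi>\<close> L_perm.rep_eq by (simp only: sum.empty)
  qed
  then obtain f where "m = mon_of n f" by blast
  then show ?thesis by (simp add: mon_of_eq_word_mon)
qed

subsection \<open>Packed words and quasisymmetry\<close>

text \<open>These sorted words without gaps stand for compositions: the runs of equal letters have
  the parts as lengths, and \<open>True\<close> starts a new run.\<close>

fun pack :: "nat \<Rightarrow> bool list \<Rightarrow> nat list" where
  "pack s [] = [s]"
| "pack s (j # js) = s # pack (if j then Suc s else s) js"

lemma length_pack [simp]: "length (pack s js) = Suc (length js)"
  by (induction js arbitrary: s) auto

lemma pack_ge: "x \<in> set (pack s js) \<Longrightarrow> s \<le> x"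
  by (induction js arbitrary: s) (auto split: if_splits dest: Suc_leD)

lemma sorted_pack: "sorted (pack s js)"
  by (induction js arbitrary: s) (auto split: if_splits dest: pack_ge)

lemma ascents_pack: "ascents (pack s js) = js"
proof (induction js arbitrary: s)
  case (Cons j js)
  then show ?case by (cases js) (auto simp flip: Cons.IH)
qed simp

lemma pack_replicate: "pack s (replicate r False @ True # js) = replicate (Suc r) s @ pack (Suc s) js"
  by (induction r) auto

lemma pack_replicate_False: "pack s (replicate r False) = replicate (Suc r) s"
  by (induction r) auto

lemma single_eq_word_mon: "Poly_Mapping.single v r = word_mon (replicate r v)"
proof (induction r)
  case (Suc r)
  then show ?case using single_add[of v 1 r] by simp
qed simp

text \<open>The identity holds for every relabelling \<open>f\<close> with one list
  \<open>js\<close>, so that the two monomials compared in the definition of \<open>QSym\<close>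
  come from the same packed word.\<close>

lemma composition_word:
  assumes "\<forall>j\<in>{s..s + p}. k j \<ge> 1"
  shows "\<exists>js. set (pack s js) \<subseteq> {s..s + p} \<and>
    (\<forall>f. (\<Sum>j\<in>{s..s + p}. Poly_Mapping.single (f j) (k j)) = word_mon (map f (pack s js)))"
  using assms
proof (induction p arbitrary: s)
  case 0
  then obtain r where "k s = Suc r" by (cases "k s") auto
  then show ?case
    by (intro exI[of _ "replicate r False"])
      (simp add: pack_replicate_False single_eq_word_mon flip: replicate_Suc)
next
  case (Suc p)
  have "k s \<ge> 1" using Suc.prems by simp
  then obtain r where r: "k s = Suc r" by (cases "k s") auto
  obtain js where js: "set (pack (Suc s) js) \<subseteq> {Suc s..Suc s + p}"
    "\<And>f. (\<Sum>j\<in>{Suc s..Suc s + p}. Poly_Mapping.single (f j) (k j)) = word_mon (map f (pack (Suc s) js))"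
    using Suc.IH[of "Suc s"] Suc.prems by auto
  have "{s..s + Suc p} = insert s {Suc s..Suc s + p}" by auto
  \<comment> \<open>The first run has \<open>k s = Suc r\<close> letters: \<open>r\<close>
    repetitions, followed by the ascent to the packed word of the remaining parts.\<close>
  with js r show ?case
    by (intro exI[of _ "replicate r False @ True # js"])
      (auto simp: pack_replicate single_eq_word_mon simp del: replicate_Suc)
qed

lemma composition_word_1:
  assumes "\<forall>j\<in>{1..p}. k j \<ge> 1" "p \<noteq> 0"
  obtains js where "set (pack 1 js) \<subseteq> {1..p}"
    "\<And>f. (\<Sum>j\<in>{1..p}. Poly_Mapping.single (f j) (k j)) = word_mon (map f (pack 1 js))"
  using composition_word[of 1 "p - 1" k] assms by auto

text \<open>A strictly increasing relabelling keeps the ascents of a packed word, and the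
  coefficient depends on the word only through its ascents.\<close>

lemma Lq_in_QSym:
  assumes I: "I \<subseteq> {1..n-1}"
  shows "Lq q n I \<in> QSym"
  unfolding QSym_def
proof (intro CollectI conjI allI impI)
  show "bounded_degree (Lq q n I)"
    unfolding bounded_degree_def by (intro exI[of _ n]) (auto dest: mon_degree_coeff_Lq)
next
  fix p :: nat and i k :: "nat \<Rightarrow> nat"
  assume i: "strict_mono_on {1..p} i" and pos: "\<forall>j\<in>{1..p}. i j \<ge> 1 \<and> k j \<ge> 1"
  show "coeff (Lq q n I) (\<Sum>j\<in>{1..p}. Poly_Mapping.single (i j) (k j)) =
        coeff (Lq q n I) (\<Sum>j\<in>{1..p}. Poly_Mapping.single j (k j))"
  proof (cases "p = 0")
    case False
    with pos obtain js where sub: "set (pack 1 js) \<subseteq> {1..p}" and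
      js: "\<And>f. (\<Sum>j\<in>{1..p}. Poly_Mapping.single (f j) (k j)) = word_mon (map f (pack 1 js))"
      using composition_word_1[of p k] by blast
    have "coeff (Lq q n I) (word_mon (map f (pack 1 js))) =
        (if n = Suc (length js) then pencil q 0 (desc_list n I) js else 0)"
      if f: "strict_mono_on {1..p} f" "\<forall>j\<in>{1..p}. f j \<ge> 1" for f
    proof (cases "n = Suc (length js)")
      case True
      have "sorted (map f (pack 1 js))"
        unfolding sorted_map
        by (rule sorted_wrt_mono_rel[OF _ sorted_pack])
          (use sub strict_mono_on_leD[OF f(1)] in blast)
      moreover have "0 \<notin> set (map f (pack 1 js))"
        using sub f(2) by fastforce
      ultimately show ?thesis
        using True I
        by (simp add: coeff_Lq_word ascents_map[OF f(1) sub] ascents_pack del: One_nat_def)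
    next
      case False
      then show ?thesis
        using mon_degree_coeff_Lq[of q n I "word_mon (map f (pack 1 js))"] by auto
    qed
    \<comment> \<open>The two monomials are the cases of \<open>i\<close> and of the
      identity.\<close>
    from this[OF i] this[of id] pos show ?thesis
      using js[of i] js[of id] by (simp add: strict_mono_on_def)
  qed simp
qed

section \<open>The vector space of quasisymmetric functions\<close>

lemma coeff_add: "coeff (F + G) m = coeff F m + coeff G m"
  by (simp add: plus_series.rep_eq)

lemma coeff_scaleR: "coeff (c *\<^sub>R F) m = c * coeff F m"
  by (simp add: scaleR_series.rep_eq)

lemma coeff_diff: "coeff (F - G) m = coeff F m - coeff G m"
  by (simp add: minus_series.rep_eq)

lemma coeff_zero: "coeff 0 m = 0"
  by (simp add: zero_series.rep_eq)

lemma coeff_sum: "coeff (\<Sum>a\<in>A. F a) m = (\<Sum>a\<in>A. coeff (F a) m)"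
  by (induction A rule: infinite_finite_induct) (simp_all add: coeff_add coeff_zero)

lemma subspace_QSym: "subspace QSym"
proof (rule subspaceI)
  show "0 \<in> QSym"
    by (simp add: QSym_def bounded_degree_def coeff_zero)
next
  fix F G assume FG: "F \<in> QSym" "G \<in> QSym"
  then obtain d e where "\<forall>m. coeff F m \<noteq> 0 \<longrightarrow> mon_degree m \<le> d"
      "\<forall>m. coeff G m \<noteq> 0 \<longrightarrow> mon_degree m \<le> e"
    by (auto simp: QSym_def bounded_degree_def)
  then have "\<forall>m. coeff (F + G) m \<noteq> 0 \<longrightarrow> mon_degree m \<le> max d e"
    by (metis add_0 coeff_add le_max_iff_disj)
  then have "bounded_degree (F + G)"
    unfolding bounded_degree_def by blast
  with FG show "F + G \<in> QSym"
    by (simp add: QSym_def coeff_add)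
next
  fix c F assume "F \<in> QSym"
  then show "c *\<^sub>R F \<in> QSym"
    by (auto simp: QSym_def bounded_degree_def coeff_scaleR)
qed

text \<open>Quasisymmetry moves the support of any nonconstant monomial to an initial segment
  \<open>{1..p}\<close>, where it becomes the monomial of a packed word.\<close>

lemma QSym_eq_0I:
  assumes F: "F \<in> QSym" and "coeff F 0 = 0" and "\<And>js. coeff F (word_mon (pack 1 js)) = 0"
  shows "F = 0"
proof -
  have "coeff F m = 0" for m
  proof (cases "0 \<in> Poly_Mapping.keys m \<or> m = 0")
    case True
    then show ?thesis using assms(2) coeff[of F] by auto
  next
    case False
    define p where "p = card (Poly_Mapping.keys m)"
    \<comment> \<open>The increasing enumeration of the support, shifted because list positions
      start at 0.\<close>
    define i where "i j = sorted_list_of_set (Poly_Mapping.keys m) ! (j - 1)" for j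
    define k where "k j = Poly_Mapping.lookup m (i j)" for j
    have p: "p \<noteq> 0" using False by (simp add: p_def)
    have mono: "strict_mono_on {1..p} i"
      by (rule strict_mono_onI)
        (auto simp: i_def p_def intro!: sorted_wrt_nth_less[OF strict_sorted_list_of_set])
    have img: "i ` {1..p} = Poly_Mapping.keys m"
    proof -
      have "i ` {1..p} = (!) (sorted_list_of_set (Poly_Mapping.keys m)) ` ((\<lambda>j. j - 1) ` {1..p})"
        by (simp add: image_image i_def)
      also have "(\<lambda>j. j - 1) ` {1..p} = {..<p}"
        by (force simp: image_iff intro: bexI[of _ "Suc _"])
      also have "(!) (sorted_list_of_set (Poly_Mapping.keys m)) ` {..<p} = Poly_Mapping.keys m"
        using set_conv_nth[of "sorted_list_of_set (Poly_Mapping.keys m)"]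
        by (auto simp: p_def)
      finally show ?thesis .
    qed
    have ik: "i j \<ge> 1 \<and> k j \<ge> 1" if "j \<in> {1..p}" for j
    proof -
      have "i j \<in> Poly_Mapping.keys m" using that img by blast
      with False show ?thesis by (auto simp: k_def in_keys_iff Suc_le_eq intro!: gr0I)
    qed
    have "(\<Sum>j\<in>{1..p}. Poly_Mapping.single (i j) (k j)) =
        (\<Sum>v\<in>Poly_Mapping.keys m. Poly_Mapping.single v (Poly_Mapping.lookup m v))"
      unfolding img[symmetric] sum.reindex[OF strict_mono_on_imp_inj_on[OF mono]]
      by (simp add: k_def)
    also have "\<dots> = m"
      by (rule poly_mapping_eqI) (auto simp: lookup_sum lookup_single when_def in_keys_iff)
    finally have "m = (\<Sum>j\<in>{1..p}. Poly_Mapping.single (i j) (k j))" ..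
    moreover have "coeff F (\<Sum>j\<in>{1..p}. Poly_Mapping.single (i j) (k j)) =
        coeff F (\<Sum>j\<in>{1..p}. Poly_Mapping.single j (k j))"
    proof -
      have "strict_mono_on {1..p} i \<longrightarrow> (\<forall>j\<in>{1..p}. i j \<ge> 1 \<and> k j \<ge> 1) \<longrightarrow> ?thesis"
        using F unfolding QSym_def mem_Collect_eq by (elim conjE allE)
      with mono ik show ?thesis by blast
    qed
    moreover have "\<forall>j\<in>{1..p}. k j \<ge> 1" using ik by blast
    then obtain js where "set (pack 1 js) \<subseteq> {1..p}" and
      js: "\<And>f. (\<Sum>j\<in>{1..p}. Poly_Mapping.single (f j) (k j)) = word_mon (map f (pack 1 js))"
      by (rule composition_word_1[OF _ p]) blast
    ultimately show ?thesis
      using assms(3)[of js] js[of "\<lambda>j. j"] by (simp del: One_nat_def)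
  qed
  then show ?thesis
    by (simp add: coeff_zero fun_eq_iff flip: coeff_inject)
qed

subsection \<open>The basis property\<close>

text \<open>Because \<open>n - 1\<close> is truncated, degrees 0 and 1 share the empty list; the
  case distinction tells their monomials apart.\<close>

definition packed_mon :: "nat \<Rightarrow> bool list \<Rightarrow> (nat \<Rightarrow>\<^sub>0 nat)" where
  "packed_mon n js = (if n = 0 then 0 else word_mon (pack 1 js))"

definition graded_matrix :: "real \<Rightarrow> nat \<Rightarrow> bool list \<Rightarrow> bool list \<Rightarrow> real" where
  "graded_matrix q n is js = (if n = 0 then 1 else pencil q 0 is js)"

lemma coeff_Lq_packed:
  assumes "I \<subseteq> {1..n-1}" "length js = n - 1"
  shows "coeff (Lq q n I) (packed_mon n js) = graded_matrix q n (desc_list n I) js"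
proof (cases "n = 0")
  case True
  with assms show ?thesis by (simp add: packed_mon_def graded_matrix_def coeff_Lq_0)
next
  case False
  then show ?thesis
    using assms coeff_Lq_word[of "pack 1 js" n I q] pack_ge[of 0 1 js]
    by (auto simp: packed_mon_def graded_matrix_def sorted_pack ascents_pack)
qed

lemma mon_degree_packed_mon: "length js = n - 1 \<Longrightarrow> mon_degree (packed_mon n js) = n"
  by (simp add: packed_mon_def) (simp add: mon_degree_def)

lemma sum_desc_list:
  "(\<Sum>I\<in>Pow {1..n-1}. h (desc_list n I)) = (\<Sum>xs\<in>lists_of (n - 1). h xs)"
proof (rule sum.reindex_bij_witness[where j = "desc_list n"
      and i = "\<lambda>xs. {a \<in> {1..n-1}. xs ! (a - 1)}"])
  fix I assume "I \<in> Pow {1..n-1}"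
  then show "{a \<in> {1..n-1}. desc_list n I ! (a - 1)} = I"
    by (rule Collect_desc_list)
next
  fix xs assume "xs \<in> lists_of (n - 1)"
  then show "desc_list n {a \<in> {1..n-1}. xs ! (a - 1)} = xs"
    by (auto simp: nth_desc_list intro!: nth_equalityI)
qed auto

lemma desc_list_inject: "inj_on (desc_list n) (Pow {1..n-1})"
  by (rule inj_on_inverseI[where g = "\<lambda>xs. {a \<in> {1..n-1}. xs ! (a - 1)}"])
    (rule Collect_desc_list)

lemma graded_matrix_injective:
  assumes "q \<notin> {-1, 1}"
    and "\<And>js. length js = n - 1 \<Longrightarrow> (\<Sum>xs\<in>lists_of (n - 1). w xs * graded_matrix q n xs js) = 0"
    and "length xs = n - 1"
  shows "w xs = 0"
proof (cases "n = 0")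
  case True
  with assms(2)[of "[]"] assms(3) show ?thesis by (simp add: graded_matrix_def)
next
  case False
  with assms pencil_injective[of q "n - 1" w 0 xs] show ?thesis by (simp add: graded_matrix_def)
qed

lemma graded_matrix_surjective:
  assumes "q \<notin> {-1, 1}"
  shows "\<exists>w. \<forall>js. length js = n - 1 \<longrightarrow>
    (\<Sum>xs\<in>lists_of (n - 1). w xs * graded_matrix q n xs js) = v js"
proof (cases "n = 0")
  case True
  then show ?thesis by (intro exI[of _ "\<lambda>_. v []"]) (simp add: graded_matrix_def)
next
  case False
  with pencil_surjective[OF assms, of "n - 1" 0 v] show ?thesis by (simp add: graded_matrix_def)
qed

section \<open>Spanning\<close>

lemma QSym_subset_span:
  assumes q: "q \<notin> {-1, 1}"
  shows "QSym \<subseteq> span ((\<lambda>(n, I). Lq q n I) ` Lq_index)"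
proof
  fix F assume F: "F \<in> QSym"
  then obtain d where d: "\<And>m. coeff F m \<noteq> 0 \<Longrightarrow> mon_degree m \<le> d"
    by (auto simp: QSym_def bounded_degree_def)
  have "\<forall>n. \<exists>w. \<forall>js. length js = n - 1 \<longrightarrow>
      (\<Sum>xs\<in>lists_of (n - 1). w xs * graded_matrix q n xs js) = coeff F (packed_mon n js)"
    by (intro allI graded_matrix_surjective[OF q])
  \<comment> \<open>Each degree is solved separately; the degree bound \<open>d\<close> of
    \<open>F\<close> makes the resulting combination finite.\<close>
  from choice[OF this] obtain w where w: "\<And>n js. length js = n - 1 \<Longrightarrow>
      (\<Sum>xs\<in>lists_of (n - 1). w n xs * graded_matrix q n xs js) = coeff F (packed_mon n js)"
    by blast
  define G where "G = (\<Sum>n\<le>d. \<Sum>I\<in>Pow {1..n-1}. w n (desc_list n I) *\<^sub>R Lq q n I)"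
  have G: "G \<in> span ((\<lambda>(n, I). Lq q n I) ` Lq_index)"
    unfolding G_def by (intro span_sum span_scale span_base) (force simp: Lq_index_def)
  have "G \<in> QSym"
    unfolding G_def
    by (intro subspace_sum subspace_scale subspace_QSym Lq_in_QSym) auto
  have eq: "coeff G (packed_mon N js) = coeff F (packed_mon N js)" if js: "length js = N - 1" for N js
  proof -
    have deg: "mon_degree (packed_mon N js) = N"
      using js by (rule mon_degree_packed_mon)
    have "coeff G (packed_mon N js) = (\<Sum>n\<le>d. if n = N then coeff F (packed_mon N js) else 0)"
      unfolding G_def coeff_sum coeff_scaleR
    proof (rule sum.cong[OF refl])
      fix n
      show "(\<Sum>I\<in>Pow {1..n-1}. w n (desc_list n I) * coeff (Lq q n I) (packed_mon N js)) =
          (if n = N then coeff F (packed_mon N js) else 0)"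
      proof (cases "n = N")
        case True
        then have "(\<Sum>I\<in>Pow {1..n-1}. w n (desc_list n I) * coeff (Lq q n I) (packed_mon N js)) =
            (\<Sum>I\<in>Pow {1..n-1}. w n (desc_list n I) * graded_matrix q n (desc_list n I) js)"
          using js by (intro sum.cong refl) (simp add: coeff_Lq_packed)
        also have "\<dots> = coeff F (packed_mon n js)"
          using sum_desc_list[of "\<lambda>xs. w n xs * graded_matrix q n xs js" n] w js True by simp
        finally show ?thesis using True by simp
      next
        case False
        then have "coeff (Lq q n I) (packed_mon N js) = 0" for I
          using mon_degree_coeff_Lq deg by metis
        with False show ?thesis by simp
      qed
    qed
    \<comment> \<open>For \<open>N > d\<close> the sum has no matching term, and the coefficient of
      \<open>F\<close> vanishes by the degree bound.\<close>
    also have "\<dots> = coeff F (packed_mon N js)"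
      using d[of "packed_mon N js"] deg by auto
    finally show ?thesis .
  qed
  have "F - G = 0"
  proof (rule QSym_eq_0I)
    show "F - G \<in> QSym"
      using subspace_QSym F \<open>G \<in> QSym\<close> by (rule subspace_diff)
    show "coeff (F - G) 0 = 0"
      using eq[of "[]" 0] by (simp add: coeff_diff packed_mon_def)
    show "coeff (F - G) (word_mon (pack 1 js)) = 0" for js
      using eq[of js "Suc (length js)"] by (simp add: coeff_diff packed_mon_def)
  qed
  with G show "F \<in> span ((\<lambda>(n, I). Lq q n I) ` Lq_index)" by simp
qed

section \<open>Linear independence\<close>

lemma independent_familyI:
  fixes f :: "'a \<Rightarrow> 'b :: real_vector"
  assumes zero: "\<And>T c t. finite T \<Longrightarrow> T \<subseteq> S \<Longrightarrow> (\<Sum>t\<in>T. c t *\<^sub>R f t) = 0 \<Longrightarrow> t \<in> T \<Longrightarrow> c t = 0"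
  shows "inj_on f S \<and> independent (f ` S)"
proof
  show inj: "inj_on f S"
  proof (rule inj_onI, rule ccontr)
    fix x y assume xy: "x \<in> S" "y \<in> S" "f x = f y" "x \<noteq> y"
    \<comment> \<open>Two equal members would satisfy the relation with coefficients 1 and
      -1.\<close>
    then show False
      using zero[of "{x, y}" "\<lambda>t. if t = x then 1 else - 1" x] by auto
  qed
  show "independent (f ` S)"
    unfolding independent_explicit_module
  proof (intro allI impI)
    fix U u v assume U: "finite U" "U \<subseteq> f ` S" "(\<Sum>v\<in>U. u v *\<^sub>R v) = 0" "v \<in> U"
    obtain T where T: "T \<subseteq> S" "finite T" "U = f ` T"
      using finite_subset_image[OF U(1,2)] by blast
    have "(\<Sum>t\<in>T. u (f t) *\<^sub>R f t) = 0"
      using U(3) unfolding T(3) sum.reindex[OF inj_on_subset[OF inj T(1)]] by simp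
    moreover obtain t where "t \<in> T" "v = f t"
      using U(4) T(3) by blast
    ultimately show "u v = 0"
      using zero[OF T(2,1), of "\<lambda>t. u (f t)" t] by simp
  qed
qed

text \<open>Coefficients at packed monomials of degree \<open>n\<close> see only the members of
  degree \<open>n\<close>, so a relation yields a vector annihilated by the matrix of that
  degree.\<close>

lemma Lq_linear_independent:
  assumes q: "q \<notin> {-1, 1}" and T: "finite T" "T \<subseteq> Lq_index"
    and zero: "(\<Sum>t\<in>T. c t *\<^sub>R (case t of (n, I) \<Rightarrow> Lq q n I)) = 0" and t: "t \<in> T"
  shows "c t = 0"
proof -
  obtain n I where nI: "t = (n, I)" by (cases t)
  \<comment> \<open>The coefficients of degree \<open>n\<close> are extended by 0 to all subsets,
    and \<open>w\<close> transports them to bool lists.\<close>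
  define e where "e J = (if (n, J) \<in> T then c (n, J) else 0)" for J
  define w where "w xs = e (inv_into (Pow {1..n-1}) (desc_list n) xs)" for xs
  have w: "w (desc_list n J) = e J" if "J \<in> Pow {1..n-1}" for J
    unfolding w_def inv_into_f_f[OF desc_list_inject that] ..
  have I: "I \<in> Pow {1..n-1}"
    using t T nI by (auto simp: Lq_index_def)
  have "(\<Sum>xs\<in>lists_of (n - 1). w xs * graded_matrix q n xs js) = 0" if js: "length js = n - 1" for js
  proof -
    let ?m = "packed_mon n js"
    let ?h = "\<lambda>t. c t * coeff (case t of (n, I) \<Rightarrow> Lq q n I) ?m"
    have "(\<Sum>xs\<in>lists_of (n - 1). w xs * graded_matrix q n xs js) =
        (\<Sum>J\<in>Pow {1..n-1}. e J * coeff (Lq q n J) ?m)"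
      unfolding sum_desc_list[symmetric] using js by (intro sum.cong refl) (simp add: w coeff_Lq_packed)
    also have "\<dots> = (\<Sum>J\<in>{J \<in> Pow {1..n-1}. (n, J) \<in> T}. ?h (n, J))"
      by (rule sum.mono_neutral_cong_right) (auto simp: e_def)
    also have "\<dots> = (\<Sum>t\<in>Pair n ` {J \<in> Pow {1..n-1}. (n, J) \<in> T}. ?h t)"
      by (subst sum.reindex) (auto intro: inj_onI)
    also have "\<dots> = (\<Sum>t\<in>T. ?h t)"
    proof (rule sum.mono_neutral_left)
      show "\<forall>t\<in>T - Pair n ` {J \<in> Pow {1..n-1}. (n, J) \<in> T}. ?h t = 0"
      proof
        fix t assume "t \<in> T - Pair n ` {J \<in> Pow {1..n-1}. (n, J) \<in> T}"
        \<comment> \<open>An index in \<open>T\<close> with first component \<open>n\<close> would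
          lie in the image, since all indices in \<open>T\<close> are admissible.\<close>
        then obtain n' J where "t = (n', J)" "n' \<noteq> n"
          using T(2) by (cases t) (auto simp: Lq_index_def)
        then show "?h t = 0"
          using mon_degree_coeff_Lq[of q n' J ?m] mon_degree_packed_mon[OF js] by auto
      qed
    qed (use T in auto)
    also have "\<dots> = coeff (\<Sum>t\<in>T. c t *\<^sub>R (case t of (n, I) \<Rightarrow> Lq q n I)) ?m"
      by (simp add: coeff_sum coeff_scaleR)
    finally show ?thesis
      by (simp add: zero coeff_zero)
  qed
  then have "w (desc_list n I) = 0"
    by (rule graded_matrix_injective[OF q]) simp_all
  with w[OF I] t nI show ?thesis by (simp add: e_def)
qed

theorem theorem4p4:
  fixes q :: real
  assumes "q \<notin> {-1, 1}"
  shows "inj_on (\<lambda>(n, I). Lq q n I) Lq_index \<and>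
    independent ((\<lambda>(n, I). Lq q n I) ` Lq_index) \<and>
    span ((\<lambda>(n, I). Lq q n I) ` Lq_index) = QSym"
proof -
  have "span ((\<lambda>(n, I). Lq q n I) ` Lq_index) \<subseteq> QSym"
    by (rule span_minimal[OF _ subspace_QSym]) (auto simp: Lq_index_def Lq_in_QSym)
  then show ?thesis
    using independent_familyI[of Lq_index "\<lambda>(n, I). Lq q n I"]
      Lq_linear_independent[OF assms] QSym_subset_span[OF assms] by blast
qed

end
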